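(* For any integers $r\ge 3$ and $1 \leq k \leq n_1 \leq n_2 \leq \cdots \leq n_r$, \[ \operatorname{ex}(K_{n_1, \ldots , n_r}, kK_r) = \sum_{1\leq i<j\leq r}n_in_j - n_1n_2 + n_2(k-1). \]
   Context: All graphs are finite, undirected and simple. $K_{n_1,\ldots,n_r}$ denotes the complete $r$-partite graph with parts $V_1,\dots,V_r$ of sizes $|V_i|=n_i$ (each $V_i$ independent, all edges between distinct parts present). $K_r$ is the complete graph on $r$ vertices, and $kK_r$ denotes $k$ vertex-disjoint copies of $K_r$. For graphs $G$ and $H$, the Turán number $\operatorname{ex}(G,H)$ is the maximum number of edges in a subgraph of $G$ that contains no copy of $H$. *)

theory Defs
  imports Main
begin

(* Finite undirected simple graphs; an edge is the two-element set of its endpoints. *)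

record 'a graph =
  verts :: "'a set"
  edges :: "'a set set"

definition simple_graph :: "'a graph \<Rightarrow> bool" where
  "simple_graph G \<longleftrightarrow>
     finite (verts G) \<and> (\<forall>e\<in>edges G. e \<subseteq> verts G \<and> card e = 2)"

definition subgraph :: "'a graph \<Rightarrow> 'a graph \<Rightarrow> bool" where
  "subgraph H G \<longleftrightarrow> simple_graph H \<and> verts H \<subseteq> verts G \<and> edges H \<subseteq> edges G"

definition isomorphic :: "'a graph \<Rightarrow> 'b graph \<Rightarrow> bool" where
  "isomorphic G H \<longleftrightarrow>
     (\<exists>f. bij_betw f (verts G) (verts H) \<and> edges H = (\<lambda>e. f ` e) ` edges G)"

(* A copy is a subgraph that need not be induced. *)

definition contains_copy :: "'a graph \<Rightarrow> 'b graph \<Rightarrow> bool" where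
  "contains_copy G H \<longleftrightarrow> (\<exists>H'. subgraph H' G \<and> isomorphic H H')"

definition turan_number :: "'a graph \<Rightarrow> 'b graph \<Rightarrow> nat" where
  "turan_number G H =
     Max {card (edges G') | G'. subgraph G' G \<and> \<not> contains_copy G' H}"

definition complete_graph :: "nat \<Rightarrow> nat graph" where
  "complete_graph r =
     \<lparr>verts = {1..r}, edges = {{u, v} | u v. u \<in> {1..r} \<and> v \<in> {1..r} \<and> u \<noteq> v}\<rparr>"

(* The vertex (c, v) is the vertex v of the c-th copy. *)

definition disjoint_copies :: "nat \<Rightarrow> 'a graph \<Rightarrow> (nat \<times> 'a) graph" where
  "disjoint_copies k G =
     \<lparr>verts = {1..k} \<times> verts G, edges = {Pair c ` e | c e. c \<in> {1..k} \<and> e \<in> edges G}\<rparr>"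

(* The i-th part, for i = 1, ..., r, is {i} \<times> {1..n i}; values of n outside {1..r} are irrelevant. *)

definition complete_multipartite :: "nat \<Rightarrow> (nat \<Rightarrow> nat) \<Rightarrow> (nat \<times> nat) graph" where
  "complete_multipartite r n =
     \<lparr>verts = (SIGMA i:{1..r}. {1..n i}),
      edges = {{(i, a), (j, b)} | i a j b.
        i \<in> {1..r} \<and> a \<in> {1..n i} \<and> j \<in> {1..r} \<and> b \<in> {1..n j} \<and> i \<noteq> j}\<rparr>"

lemma simple_graph_complete_graph: "simple_graph (complete_graph r)"
  by (auto simp: simple_graph_def complete_graph_def)

lemma simple_graph_disjoint_copies:
  assumes "simple_graph G"
  shows "simple_graph (disjoint_copies k G)"
  using assms
  by (auto simp: simple_graph_def disjoint_copies_def card_image inj_on_def)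

lemma simple_graph_complete_multipartite: "simple_graph (complete_multipartite r n)"
  by (auto simp: simple_graph_def complete_multipartite_def)

(* The maximum defining turan_number ranges over a finite set, which is nonempty
   as soon as H has a vertex. *)

lemma finite_turan_candidates:
  assumes "simple_graph G"
  shows "finite {card (edges G') | G'. subgraph G' G \<and> \<not> contains_copy G' H}"
proof -
  have "edges G \<subseteq> Pow (verts G)" "finite (verts G)"
    using assms by (auto simp: simple_graph_def)
  then have "finite (edges G)"
    by (meson finite_Pow_iff finite_subset)
  then have "{card (edges G') | G'. subgraph G' G \<and> \<not> contains_copy G' H} \<subseteq> {..card (edges G)}"
    by (auto simp: subgraph_def intro: card_mono)
  then show ?thesis
    by (rule finite_subset) simp
qed

lemma turan_candidates_nonempty:
  assumes "verts H \<noteq> {}"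
  shows "{card (edges G') | G'. subgraph G' G \<and> \<not> contains_copy G' H} \<noteq> {}"
proof -
  let ?E = "\<lparr>verts = {}, edges = {}\<rparr>"
  have "subgraph ?E G"
    by (simp add: subgraph_def simple_graph_def)
  moreover have "\<not> contains_copy ?E H"
    using assms by (auto simp: contains_copy_def subgraph_def isomorphic_def bij_betw_def)
  ultimately show ?thesis
    by blast
qed

end

(* Upper bound: let M be the set of missing edges.  A transversal is a choice of one vertex
   from each part.  Shifting a transversal f cyclically within every part by t = 0, ..., n_1 - 1
   gives n_1 pairwise disjoint transversals; if there is no kK_r, at least n_1 - k + 1 of them
   contain a missing edge.  On the other hand, a fixed edge between parts i and j lies in a fraction
   1 / (n_i n_j) <= 1 / (n_1 n_2) of all transversals, so averaging over f gives
   n_1 |M| / (n_1 n_2) >= n_1 - k + 1.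

   Lower bound: delete all edges between V_2 and n_1 - k + 1 vertices of V_1.  Every K_r meets
   every part, so it uses one of the remaining k - 1 vertices of V_1. *)

theory Submission
  imports Defs "HOL-Library.FuncSet" "HOL-Number_Theory.Cong"
begin

section \<open>Copies of a graph as injective edge-preserving maps\<close>

lemma finite_edges: "simple_graph G \<Longrightarrow> finite (edges G)"
  by (rule finite_subset[of _ "Pow (verts G)"]) (auto simp: simple_graph_def)

text \<open>An isomorphism onto a subgraph of \<open>G\<close> is an injective map carrying edges to
  edges, and conversely the image of \<open>H\<close> under such a map is a subgraph isomorphic to
  \<open>H\<close>. From here on a copy is handled through its map alone.\<close>

lemma contains_copy_iff:
  assumes "simple_graph G" "simple_graph H"
  shows "contains_copy G H \<longleftrightarrow>
    (\<exists>f. inj_on f (verts H) \<and> f ` verts H \<subseteq> verts G \<and> (\<forall>e\<in>edges H. f ` e \<in> edges G))"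
proof
  assume "contains_copy G H"
  then show "\<exists>f. inj_on f (verts H) \<and> f ` verts H \<subseteq> verts G \<and> (\<forall>e\<in>edges H. f ` e \<in> edges G)"
  proof -
    obtain H' where H': "subgraph H' G" and "isomorphic H H'"
      using \<open>contains_copy G H\<close> by (auto simp: contains_copy_def)
    then obtain f where f: "inj_on f (verts H)" "f ` verts H = verts H'"
        "edges H' = (\<lambda>e. f ` e) ` edges H"
      by (auto simp: isomorphic_def bij_betw_def)
    with H' have "f ` verts H \<subseteq> verts G" "\<forall>e\<in>edges H. f ` e \<in> edges G"
      by (auto simp: subgraph_def)
    with f(1) show ?thesis by blast
  qed
next
  assume "\<exists>f. inj_on f (verts H) \<and> f ` verts H \<subseteq> verts G \<and> (\<forall>e\<in>edges H. f ` e \<in> edges G)"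
  then obtain f where f: "inj_on f (verts H)" "f ` verts H \<subseteq> verts G"
    "\<And>e. e \<in> edges H \<Longrightarrow> f ` e \<in> edges G" by blast
  let ?H' = "\<lparr>verts = f ` verts H, edges = (\<lambda>e. f ` e) ` edges H\<rparr>"
  have "f ` e \<subseteq> f ` verts H" if "e \<in> edges H" for e
    using that assms(2) by (auto simp: simple_graph_def intro: image_mono)
  then have "subgraph ?H' G"
    using f(2,3) assms by (auto simp: subgraph_def simple_graph_def)
  moreover have "isomorphic H ?H'"
    using f(1) by (auto simp: isomorphic_def bij_betw_def)
  ultimately show "contains_copy G H"
    unfolding contains_copy_def by blast
qed

lemma edges_disjoint_copies_complete:
  "edges (disjoint_copies k (complete_graph r)) =
     {{(c, i), (c, j)} | c i j. c \<in> {1..k} \<and> i \<in> {1..r} \<and> j \<in> {1..r} \<and> i \<noteq> j}"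
    (is "?L = ?R")
proof
  show "?L \<subseteq> ?R"
  proof
    fix e assume "e \<in> ?L"
    then obtain c i j where "c \<in> {1..k}" "i \<in> {1..r}" "j \<in> {1..r}" "i \<noteq> j" "e = Pair c ` {i, j}"
      by (auto simp: disjoint_copies_def complete_graph_def)
    then show "e \<in> ?R" by (simp only: image_insert image_empty) blast
  qed
  show "?R \<subseteq> ?L"
  proof
    fix e assume "e \<in> ?R"
    then obtain c i j where "c \<in> {1..k}" "i \<in> {1..r}" "j \<in> {1..r}" "i \<noteq> j" and e: "e = Pair c ` {i, j}"
      by auto
    then have "{i, j} \<in> edges (complete_graph r)" by (auto simp: complete_graph_def)
    with \<open>c \<in> {1..k}\<close> e show "e \<in> ?L" by (auto simp del: image_insert simp: disjoint_copies_def)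
  qed
qed

text \<open>For \<open>2 \<le> r\<close> every vertex of the cliques lies on an edge, so the edge
  condition already forces the image into \<open>verts G\<close>.\<close>

lemma contains_disjoint_cliques_iff:
  assumes "simple_graph G" "2 \<le> r"
  shows "contains_copy G (disjoint_copies k (complete_graph r)) \<longleftrightarrow>
    (\<exists>f. inj_on f ({1..k} \<times> {1..r}) \<and>
      (\<forall>c\<in>{1..k}. \<forall>i\<in>{1..r}. \<forall>j\<in>{1..r}. i \<noteq> j \<longrightarrow> {f (c, i), f (c, j)} \<in> edges G))"
    (is "?L \<longleftrightarrow> ?R")
proof -
  let ?H = "disjoint_copies k (complete_graph r)"
  have sH: "simple_graph ?H"
    by (intro simple_graph_disjoint_copies simple_graph_complete_graph)
  have vH: "verts ?H = {1..k} \<times> {1..r}"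
    by (simp add: disjoint_copies_def complete_graph_def)
  have eH: "(\<forall>e\<in>edges ?H. f ` e \<in> edges G) \<longleftrightarrow>
      (\<forall>c\<in>{1..k}. \<forall>i\<in>{1..r}. \<forall>j\<in>{1..r}. i \<noteq> j \<longrightarrow> {f (c, i), f (c, j)} \<in> edges G)"
      (is "?A \<longleftrightarrow> ?B")
    for f :: "nat \<times> nat \<Rightarrow> 'a"
  proof
    assume A: ?A
    show ?B
    proof (intro ballI impI)
      fix c i j assume "c \<in> {1..k}" "i \<in> {1..r}" "j \<in> {1..r}" "i \<noteq> j"
      then have "{(c, i), (c, j)} \<in> edges ?H"
        unfolding edges_disjoint_copies_complete by blast
      with A have "f ` {(c, i), (c, j)} \<in> edges G" by blast
      then show "{f (c, i), f (c, j)} \<in> edges G" by simp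
    qed
  next
    assume ?B
    then show ?A
      unfolding edges_disjoint_copies_complete by (auto simp del: atLeastAtMost_iff)
  qed
  have vG: "f ` ({1..k} \<times> {1..r}) \<subseteq> verts G"
    if f: "\<forall>c\<in>{1..k}. \<forall>i\<in>{1..r}. \<forall>j\<in>{1..r}. i \<noteq> j \<longrightarrow> {f (c, i), f (c, j)} \<in> edges G"
    for f :: "nat \<times> nat \<Rightarrow> 'a"
  proof clarify
    fix c i assume ci: "c \<in> {1..k}" "i \<in> {1..r}"
    \<comment> \<open>Any second index in the same clique will do; \<open>2 \<le> r\<close> provides
      one.\<close>
    define j where "j = (if i = 1 then 2 else 1 :: nat)"
    have "j \<in> {1..r}" "i \<noteq> j" using assms(2) by (auto simp: j_def)
    with f ci have "{f (c, i), f (c, j)} \<in> edges G" by blast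
    then show "f (c, i) \<in> verts G" using assms(1) by (auto simp: simple_graph_def)
  qed
  show ?thesis
    unfolding contains_copy_iff[OF assms(1) sH] vH eH using vG by blast
qed

section \<open>The number of edges of the complete multipartite graph\<close>

lemma card_edges_complete_multipartite:
  "card (edges (complete_multipartite r n)) =
     (\<Sum>(i, j) \<in> {(i, j). 1 \<le> i \<and> i < j \<and> j \<le> r}. n i * n j)"
proof -
  define P where "P = {(i, j). 1 \<le> i \<and> i < j \<and> j \<le> r}"
  define S where "S = (SIGMA p:P. {1..n (fst p)} \<times> {1..n (snd p)})"
  \<comment> \<open>Orienting each edge from the part of smaller index to the part of larger index
    gives every edge exactly one preimage under \<open>h\<close>.\<close>
  define h where "h = (\<lambda>((i :: nat, j :: nat), (a :: nat, b :: nat)). {(i, a), (j, b)})"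
  have "finite P"
    by (rule finite_subset[of _ "{1..r} \<times> {1..r}"]) (auto simp: P_def)
  have "inj_on h S"
    by (rule inj_onI) (auto simp: h_def S_def P_def doubleton_eq_iff)
  moreover have "h ` S = edges (complete_multipartite r n)"
  proof
    show "h ` S \<subseteq> edges (complete_multipartite r n)"
      by (fastforce simp: h_def S_def P_def complete_multipartite_def)
    show "edges (complete_multipartite r n) \<subseteq> h ` S"
    proof
      fix e assume "e \<in> edges (complete_multipartite r n)"
      then obtain i a j b where e: "e = {(i, a), (j, b)}" "i \<in> {1..r}" "a \<in> {1..n i}"
        "j \<in> {1..r}" "b \<in> {1..n j}" "i \<noteq> j" by (auto simp: complete_multipartite_def)
      consider "i < j" | "j < i" using e(6) by linarith
      then show "e \<in> h ` S"
      proof cases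
        case 1
        then have "((i, j), (a, b)) \<in> S" using e by (auto simp: S_def P_def)
        moreover have "e = h ((i, j), (a, b))" by (simp add: h_def e(1))
        ultimately show ?thesis by blast
      next
        case 2
        then have "((j, i), (b, a)) \<in> S" using e by (auto simp: S_def P_def)
        moreover have "e = h ((j, i), (b, a))" by (simp add: h_def e(1) insert_commute)
        ultimately show ?thesis by blast
      qed
    qed
  qed
  ultimately have "card (edges (complete_multipartite r n)) = card S"
    by (metis card_image)
  also have "\<dots> = (\<Sum>p\<in>P. n (fst p) * n (snd p))"
    unfolding S_def using \<open>finite P\<close> by (simp add: card_cartesian_product)
  finally show ?thesis
    by (simp add: P_def case_prod_beta)
qed

section \<open>Transversals and their cyclic shifts\<close>

definition transversals :: "nat \<Rightarrow> (nat \<Rightarrow> nat) \<Rightarrow> (nat \<Rightarrow> nat) set" where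
  "transversals r n = (\<Pi>\<^sub>E i\<in>{1..r}. {1..n i})"

definition transversal_verts :: "nat \<Rightarrow> (nat \<Rightarrow> nat) \<Rightarrow> (nat \<times> nat) set" where
  "transversal_verts r f = (\<lambda>i. (i, f i)) ` {1..r}"

text \<open>Parts are numbered from 1, so adding \<open>t\<close>, reducing and adding 1 rotates
  part \<open>i\<close> by \<open>t + 1\<close> positions. The offset is harmless: only distinctness
  for different \<open>t\<close> and bijectivity for each \<open>t\<close> matter. The restriction
  to \<open>{1..r}\<close> keeps the result extensional, hence in
  \<open>transversals r n\<close>.\<close>

definition shift :: "nat \<Rightarrow> (nat \<Rightarrow> nat) \<Rightarrow> nat \<Rightarrow> (nat \<Rightarrow> nat) \<Rightarrow> nat \<Rightarrow> nat" where
  "shift r n t f = (\<lambda>i\<in>{1..r}. (f i + t) mod n i + 1)"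

lemma finite_transversals: "finite (transversals r n)"
  by (simp add: transversals_def finite_PiE)

lemma card_transversals: "card (transversals r n) = (\<Prod>i\<in>{1..r}. n i)"
  by (simp add: transversals_def card_PiE)

lemma mod_cancel_bounded:
  fixes x y m t :: nat
  assumes "(x + t) mod m = (y + t) mod m" "x \<in> {1..m}" "y \<in> {1..m}"
  shows "x = y"
proof -
  have "[x = y] (mod m)" using assms(1) by (simp add: cong_def[symmetric] cong_add_rcancel_nat)
  \<comment> \<open>Subtracting 1 moves the representatives to 0, ..., m - 1, where congruence
    modulo \<open>m\<close> is equality.\<close>
  then have "[x - 1 = y - 1] (mod m)"
    using assms(2,3) by (metis atLeastAtMost_iff cong_add_rcancel_nat le_add_diff_inverse2)
  then have "x - 1 = y - 1" using assms(2,3) by (auto simp: cong_def)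
  then show ?thesis using assms(2,3) by auto
qed

lemma bij_betw_shift:
  assumes "\<And>i. i \<in> {1..r} \<Longrightarrow> 0 < n i"
  shows "bij_betw (shift r n t) (transversals r n) (transversals r n)"
proof -
  have "shift r n t ` transversals r n \<subseteq> transversals r n"
    using assms by (auto simp: shift_def transversals_def PiE_iff Suc_le_eq)
  moreover have "inj_on (shift r n t) (transversals r n)"
  proof (rule inj_onI)
    fix f g assume f: "f \<in> transversals r n" and g: "g \<in> transversals r n"
      and eq: "shift r n t f = shift r n t g"
    have "f i = g i" if i: "i \<in> {1..r}" for i
    proof (rule mod_cancel_bounded)
      show "(f i + t) mod n i = (g i + t) mod n i"
        using fun_cong[OF eq, of i] i by (simp add: shift_def)
      show "f i \<in> {1..n i}" "g i \<in> {1..n i}"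
        using f g i by (auto simp: transversals_def PiE_iff)
    qed
    then show "f = g" using f g unfolding transversals_def by (metis PiE_ext)
  qed
  ultimately show ?thesis
    by (metis bij_betw_def endo_inj_surj finite_transversals)
qed

text \<open>An edge between parts \<open>i\<close> and \<open>j\<close> fixes two coordinates, so
  the transversals through it number the product of the other part sizes. Since n is monotone,
  \<open>n i * n j\<close> is at least \<open>n 1 * n 2\<close>. The bound on the fraction is stated
  with denominators cleared.\<close>

lemma card_transversals_through_edge:
  assumes e: "e \<in> edges (complete_multipartite r n)" and mono: "mono_on {1..r} n" and "2 \<le> r"
  shows "card {f \<in> transversals r n. e \<subseteq> transversal_verts r f} * (n 1 * n 2)
    \<le> card (transversals r n)"
proof -
  obtain i a j b where e: "e = {(i, a), (j, b)}" "i \<in> {1..r}" "a \<in> {1..n i}"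
    "j \<in> {1..r}" "b \<in> {1..n j}" "i \<noteq> j"
    using e by (auto simp: complete_multipartite_def)
  \<comment> \<open>Pinning coordinates \<open>i\<close> and \<open>j\<close> to the endpoints of
    the edge leaves a product set, whose cardinality is again a product.\<close>
  define B where "B = (\<lambda>l. if l = i then {a} else if l = j then {b} else {1..n l})"
  have split_prod: "(\<Prod>l\<in>{1..r}. g l) = g i * (g j * (\<Prod>l\<in>{1..r} - {i} - {j}. g l))"
    for g :: "nat \<Rightarrow> nat"
    using prod.remove[of "{1..r}" i g] prod.remove[of "{1..r} - {i}" j g] e(2,4,6) by simp
  have "{f \<in> transversals r n. e \<subseteq> transversal_verts r f} = (\<Pi>\<^sub>E l\<in>{1..r}. B l)"
  proof -
    have "e \<subseteq> transversal_verts r f \<longleftrightarrow> f i = a \<and> f j = b" for f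
      using e(2,4) unfolding e(1) by (auto simp: transversal_verts_def)
    then show ?thesis
      using e(2-6)
      by (auto simp: transversals_def PiE_iff extensional_def B_def
          simp del: atLeastAtMost_iff split: if_splits)
  qed
  then have "card {f \<in> transversals r n. e \<subseteq> transversal_verts r f} = (\<Prod>l\<in>{1..r}. card (B l))"
    by (simp add: card_PiE)
  also have "\<dots> = card (B i) * (card (B j) * (\<Prod>l\<in>{1..r} - {i} - {j}. card (B l)))"
    by (rule split_prod)
  also have "\<dots> = (\<Prod>l\<in>{1..r} - {i} - {j}. n l)"
    by (auto simp: B_def intro!: prod.cong)
  finally have 1: "card {f \<in> transversals r n. e \<subseteq> transversal_verts r f}
    = (\<Prod>l\<in>{1..r} - {i} - {j}. n l)" .
  have 2: "card (transversals r n) = n i * (n j * (\<Prod>l\<in>{1..r} - {i} - {j}. n l))"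
    unfolding card_transversals by (rule split_prod)
  \<comment> \<open>Here \<open>p\<close> is at least 1 and \<open>q\<close> at least 2, so
    monotonicity compares the factors one by one. The edge is unordered, so this is applied below in
    whichever order \<open>i\<close> and \<open>j\<close> come.\<close>
  have le: "n p * n q \<ge> n 1 * n 2" if "p \<in> {1..r}" "q \<in> {1..r}" "p < q" for p q
    by (rule mult_mono) (use that \<open>2 \<le> r\<close> in \<open>auto intro!: mono_onD[OF mono]\<close>)
  have "n 1 * n 2 \<le> n i * n j"
    using le[of i j] le[of j i] e by (metis linorder_neqE_nat mult.commute)
  then have "(\<Prod>l\<in>{1..r} - {i} - {j}. n l) * (n 1 * n 2) \<le> (\<Prod>l\<in>{1..r} - {i} - {j}. n l) * (n i * n j)"
    by (rule mult_left_mono) simp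
  then show ?thesis
    unfolding 1 2 by (simp add: mult_ac)
qed

section \<open>Averaging the missing edges over all transversals\<close>

lemma card_le_sum_card:
  fixes X :: "'a \<Rightarrow> 'b set"
  assumes "finite T" "\<And>t. t \<in> T \<Longrightarrow> finite (X t)"
  shows "card {t \<in> T. X t \<noteq> {}} \<le> (\<Sum>t\<in>T. card (X t))"
proof -
  have "card {t \<in> T. X t \<noteq> {}} = (\<Sum>t\<in>T. if X t \<noteq> {} then 1 else 0)"
    using assms(1) by (simp add: sum.If_cases Int_def)
  also have "\<dots> \<le> (\<Sum>t\<in>T. card (X t))"
    using assms(2) by (intro sum_mono) (auto simp: Suc_le_eq card_gt_0_iff)
  finally show ?thesis .
qed

text \<open>A shifted transversal without missing edges spans a clique of \<open>G\<close>.
  Different shifts \<open>t < n 1\<close> differ in every part, since each part has at least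
  \<open>n 1\<close> vertices, so \<open>k\<close> such shifts give disjoint cliques.\<close>

lemma contains_disjoint_cliques_if_shifts:
  assumes G: "subgraph G (complete_multipartite r n)" and "2 \<le> r"
    and pos: "0 < n 1" and mono: "mono_on {1..r} n"
    and M: "M = edges (complete_multipartite r n) - edges G"
    and f: "f \<in> transversals r n"
    and k: "k \<le> card {t \<in> {..<n 1}. {e \<in> M. e \<subseteq> transversal_verts r (shift r n t f)} = {}}"
  shows "contains_copy G (disjoint_copies k (complete_graph r))"
proof -
  let ?T = "{t \<in> {..<n 1}. {e \<in> M. e \<subseteq> transversal_verts r (shift r n t f)} = {}}"
  have n1: "n 1 \<le> n i" if "i \<in> {1..r}" for i
    using that by (auto intro!: mono_onD[OF mono])
  have "card {1..k} \<le> card ?T" using k by simp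
  \<comment> \<open>\<open>\<tau>\<close> assigns to each copy its own shift free of missing
    edges.\<close>
  then obtain \<tau> where \<tau>: "inj_on \<tau> {1..k}" "\<tau> ` {1..k} \<subseteq> ?T"
    using card_le_inj[of "{1..k}" ?T] by auto
  define F where "F = (\<lambda>(c, i). (i, shift r n (\<tau> c) f i))"
  have "inj_on F ({1..k} \<times> {1..r})"
  proof (rule inj_onI, clarify)
    fix c i d j assume c: "c \<in> {1..k}" "d \<in> {1..k}" and i: "i \<in> {1..r}"
      and eq: "F (c, i) = F (d, j)"
    have j: "j = i" and mod: "(\<tau> c + f i) mod n i = (\<tau> d + f i) mod n i"
      using eq i by (auto simp: F_def shift_def add.commute)
    \<comment> \<open>Both shifts are below the modulus, so their congruence modulo
      \<open>n i\<close> makes them equal.\<close>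
    have "\<tau> c < n i" "\<tau> d < n i" using c \<tau>(2) n1[OF i] by (fastforce intro: less_le_trans)+
    then have "\<tau> c = \<tau> d"
      using mod by (metis cong_def cong_add_rcancel_nat mod_less)
    then show "c = d \<and> i = j" using \<tau>(1) c j by (auto dest: inj_onD)
  qed
  moreover have "{F (c, i), F (c, j)} \<in> edges G"
    if c: "c \<in> {1..k}" and ij: "i \<in> {1..r}" "j \<in> {1..r}" "i \<noteq> j" for c i j
  proof -
    have "shift r n (\<tau> c) f l \<in> {1..n l}" if "l \<in> {1..r}" for l
      using pos n1[OF that] that by (auto simp: shift_def Suc_le_eq)
    with ij have "{F (c, i), F (c, j)} \<in> edges (complete_multipartite r n)"
      unfolding F_def complete_multipartite_def case_prod_conv graph.simps by blast
    moreover have "{F (c, i), F (c, j)} \<subseteq> transversal_verts r (shift r n (\<tau> c) f)"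
      using ij by (auto simp: F_def transversal_verts_def)
    ultimately show ?thesis
      using \<tau>(2) c M by blast
  qed
  ultimately show ?thesis
    using G \<open>2 \<le> r\<close> by (subst contains_disjoint_cliques_iff) (auto simp: subgraph_def)
qed

text \<open>The averaging stays within the natural numbers: incidences are summed over all
  transversals and shifts, and dividing by the number of transversals becomes a cancellation at the
  end.\<close>

lemma missing_edges_lower_bound:
  assumes G: "subgraph G (complete_multipartite r n)" and r: "2 \<le> r"
    and pos: "0 < n 1" and "k \<le> n 1" and mono: "mono_on {1..r} n"
    and no_copy: "\<not> contains_copy G (disjoint_copies k (complete_graph r))"
    and M: "M = edges (complete_multipartite r n) - edges G"
  shows "n 2 * (n 1 - k + 1) \<le> card M"
proof -
  let ?A = "transversals r n" and ?h = "\<lambda>f. {e \<in> M. e \<subseteq> transversal_verts r f}"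
  have finM: "finite M"
    using M finite_edges[OF simple_graph_complete_multipartite] by simp
  have npos: "0 < n i" if "i \<in> {1..r}" for i
    using pos mono_onD[OF mono, of 1 i] that by simp
  have many: "n 1 - k + 1 \<le> (\<Sum>t<n 1. card (?h (shift r n t f)))" if f: "f \<in> ?A" for f
  proof -
    let ?good = "{t \<in> {..<n 1}. ?h (shift r n t f) = {}}"
      and ?bad = "{t \<in> {..<n 1}. ?h (shift r n t f) \<noteq> {}}"
    \<comment> \<open>Otherwise \<open>k\<close> shifts without missing edges would produce the
      forbidden copy.\<close>
    have "card ?good < k"
      using contains_disjoint_cliques_if_shifts[OF G r pos mono M f] no_copy not_le by blast
    moreover have "card ?good + card ?bad = n 1"
    proof -
      have "card (?good \<union> ?bad) = card ?good + card ?bad"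
        by (rule card_Un_disjoint) auto
      moreover have "?good \<union> ?bad = {..<n 1}" by auto
      ultimately show ?thesis by simp
    qed
    ultimately have "n 1 - k + 1 \<le> card ?bad" using \<open>k \<le> n 1\<close> by linarith
    also have "\<dots> \<le> (\<Sum>t<n 1. card (?h (shift r n t f)))"
      by (rule card_le_sum_card) (use finM in auto)
    finally show ?thesis .
  qed
  have "card ?A * (n 1 - k + 1) \<le> (\<Sum>f\<in>?A. \<Sum>t<n 1. card (?h (shift r n t f)))"
    using sum_mono[of ?A "\<lambda>_. n 1 - k + 1", OF many] by simp
  also have "\<dots> = (\<Sum>t<n 1. \<Sum>f\<in>?A. card (?h (shift r n t f)))"
    by (rule sum.swap)
  \<comment> \<open>Each shift permutes the transversals, so the inner sum does not depend on
    \<open>t\<close>.\<close>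
  also have "\<dots> = (\<Sum>t<n 1. \<Sum>f\<in>?A. card (?h f))"
    by (intro sum.cong refl sum.reindex_bij_betw[OF bij_betw_shift] npos)
  also have "\<dots> = n 1 * (\<Sum>f\<in>?A. card (?h f))"
    by simp
  \<comment> \<open>Counting pairs of a transversal and a missing edge inside it from the side of
    the edge.\<close>
  also have "(\<Sum>f\<in>?A. card (?h f)) = (\<Sum>e\<in>M. card {f \<in> ?A. e \<subseteq> transversal_verts r f})"
    by (rule sum_multicount_gen) (use finite_transversals finM in auto)
  \<comment> \<open>The extra factor \<open>n 2\<close> completes \<open>n 1\<close> to the product
    \<open>n 1 * n 2\<close> in the bound for a single edge.\<close>
  finally have "card ?A * (n 1 - k + 1) * n 2
      \<le> n 1 * (\<Sum>e\<in>M. card {f \<in> ?A. e \<subseteq> transversal_verts r f}) * n 2"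
    by (rule mult_right_mono) simp
  also have "\<dots> = (\<Sum>e\<in>M. card {f \<in> ?A. e \<subseteq> transversal_verts r f} * (n 1 * n 2))"
    by (simp add: sum_distrib_left sum_distrib_right mult_ac)
  also have "\<dots> \<le> (\<Sum>e\<in>M. card ?A)"
    using M mono r by (intro sum_mono card_transversals_through_edge) auto
  also have "\<dots> = card ?A * card M"
    by simp
  finally have "card ?A * (n 2 * (n 1 - k + 1)) \<le> card ?A * card M"
    by (simp only: mult_ac)
  moreover have "0 < card ?A"
    unfolding card_transversals using npos by (intro prod_pos) auto
  ultimately show ?thesis by (simp only: mult_le_cancel1)
qed

section \<open>The extremal graph\<close>

definition removed_edges :: "nat \<Rightarrow> (nat \<Rightarrow> nat) \<Rightarrow> (nat \<times> nat) set set" where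
  "removed_edges k n = {{(1, a), (2, b)} | a b. a \<in> {k..n 1} \<and> b \<in> {1..n 2}}"

text \<open>The interval \<open>{k..n 1}\<close> has \<open>Suc (n 1) - k\<close> elements for every
  \<open>k\<close>; with truncated subtraction \<open>n 1 - k + 1\<close> would be wrong once
  \<open>k\<close> exceeds \<open>n 1\<close>.\<close>

lemma card_removed_edges: "card (removed_edges k n) = n 2 * (Suc (n 1) - k)"
proof -
  have "removed_edges k n = (\<lambda>(a, b). {(1, a), (2, b)}) ` ({k..n 1} \<times> {1..n 2})"
    by (auto simp: removed_edges_def doubleton_eq_iff)
  moreover have "inj_on (\<lambda>(a :: nat, b :: nat). {(1 :: nat, a), (2, b)}) ({k..n 1} \<times> {1..n 2})"
    by (auto simp: inj_on_def doubleton_eq_iff)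
  ultimately show ?thesis
    by (simp add: card_image card_cartesian_product)
qed

definition extremal_graph :: "nat \<Rightarrow> nat \<Rightarrow> (nat \<Rightarrow> nat) \<Rightarrow> (nat \<times> nat) graph" where
  "extremal_graph r k n = \<lparr>verts = verts (complete_multipartite r n),
     edges = edges (complete_multipartite r n) - removed_edges k n\<rparr>"

lemma subgraph_extremal_graph: "subgraph (extremal_graph r k n) (complete_multipartite r n)"
  using simple_graph_complete_multipartite[of r n]
  by (auto simp: subgraph_def simple_graph_def extremal_graph_def)

text \<open>The vertices of one clique lie in pairwise distinct parts, and there are as many
  vertices as parts, so parts 1 and 2 are both met. The edge between these two vertices survived the
  removal, so the one in part 1 has index below \<open>k\<close>. Disjointness of the cliques then
  contradicts the pigeonhole principle.\<close>

lemma extremal_graph_no_copy: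
  assumes "2 \<le> r" "1 \<le> k"
  shows "\<not> contains_copy (extremal_graph r k n) (disjoint_copies k (complete_graph r))"
proof
  assume "contains_copy (extremal_graph r k n) (disjoint_copies k (complete_graph r))"
  then obtain F where inj: "inj_on F ({1..k} \<times> {1..r})"
    and F: "\<And>c i j. \<lbrakk>c \<in> {1..k}; i \<in> {1..r}; j \<in> {1..r}; i \<noteq> j\<rbrakk>
      \<Longrightarrow> {F (c, i), F (c, j)} \<in> edges (extremal_graph r k n)"
    using subgraph_extremal_graph[of r k n] assms(1)
    by (subst (asm) contains_disjoint_cliques_iff) (auto simp: subgraph_def)
  have "\<exists>i a. i \<in> {1..r} \<and> a \<in> {1..k - 1} \<and> F (c, i) = (1, a)" if c: "c \<in> {1..k}" for c
  proof -
    define p where "p = (\<lambda>i. fst (F (c, i)))"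
    have edge: "p i \<in> {1..r} \<and> snd (F (c, i)) \<in> {1..n (p i)} \<and> p i \<noteq> p j"
      if "i \<in> {1..r}" "j \<in> {1..r}" "i \<noteq> j" for i j
      using F[OF c that]
      by (auto simp: extremal_graph_def complete_multipartite_def doubleton_eq_iff p_def)
    \<comment> \<open>The facts in \<open>edge\<close> about a single vertex need an adjacent one;
      this supplies it.\<close>
    have other: "\<exists>j. j \<in> {1..r} \<and> i \<noteq> j" for i
      by (rule exI[of _ "if i = 1 then 2 else 1"]) (use assms(1) in auto)
    have "inj_on p {1..r}" using edge by (meson inj_onI)
    moreover have "p ` {1..r} \<subseteq> {1..r}" using edge other by (meson image_subsetI)
    ultimately have surj: "p ` {1..r} = {1..r}" by (simp add: endo_inj_surj)
    have "1 \<in> p ` {1..r}" "2 \<in> p ` {1..r}" unfolding surj using assms(1) by auto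
    then obtain i j where i: "i \<in> {1..r}" "p i = 1" and j: "j \<in> {1..r}" "p j = 2"
      by (metis imageE)
    then have "i \<noteq> j" by auto
    obtain a b where a: "F (c, i) = (1, a)" and b: "F (c, j) = (2, b)"
      using i(2) j(2) by (metis p_def prod.collapse)
    have a_le: "a \<in> {1..n 1}" using edge[OF i(1) j(1) \<open>i \<noteq> j\<close>] i(2) a by auto
    have "b \<in> {1..n 2}" using edge[OF j(1) i(1)] \<open>i \<noteq> j\<close> j(2) b by auto
    moreover have "{(1, a), (2, b)} \<notin> removed_edges k n"
      using F[OF c i(1) j(1) \<open>i \<noteq> j\<close>] a b by (simp add: extremal_graph_def)
    ultimately have "a \<notin> {k..n 1}" unfolding removed_edges_def by blast
    with a_le have "a \<in> {1..k - 1}" by auto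
    with i(1) a show ?thesis by blast
  qed
  then obtain \<iota> \<alpha> where \<alpha>: "\<And>c. c \<in> {1..k} \<Longrightarrow> \<iota> c \<in> {1..r} \<and> \<alpha> c \<in> {1..k - 1} \<and> F (c, \<iota> c) = (1, \<alpha> c)"
    by metis
  \<comment> \<open>Two copies sharing their vertex in part 1 would violate injectivity of
    \<open>F\<close>.\<close>
  have "inj_on \<alpha> {1..k}"
  proof (rule inj_onI)
    fix c d assume cd: "c \<in> {1..k}" "d \<in> {1..k}" "\<alpha> c = \<alpha> d"
    then have "F (c, \<iota> c) = F (d, \<iota> d)" using \<alpha> by simp
    then have "(c, \<iota> c) = (d, \<iota> d)"
      by (rule inj_onD[OF inj]) (use \<alpha> cd in auto)
    then show "c = d" by simp
  qed
  then have "card {1..k} \<le> card {1..k - 1}"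
    by (rule card_inj_on_le) (use \<alpha> in auto)
  then show False using assms(2) by simp
qed

text \<open>Written as a sum to avoid a truncated difference. By \<open>2 \<le> r\<close> and
  \<open>1 \<le> k\<close> all removed pairs are genuine edges of the multipartite graph.\<close>

lemma card_edges_extremal_graph:
  assumes "2 \<le> r" "1 \<le> k"
  shows "card (edges (extremal_graph r k n)) + n 2 * (Suc (n 1) - k)
    = card (edges (complete_multipartite r n))"
proof -
  have sub: "removed_edges k n \<subseteq> edges (complete_multipartite r n)"
    using assms by (fastforce simp: removed_edges_def complete_multipartite_def)
  have fin: "finite (edges (complete_multipartite r n))"
    by (intro finite_edges simple_graph_complete_multipartite)
  have "card (removed_edges k n) \<le> card (edges (complete_multipartite r n))"
    using sub fin by (rule card_mono[rotated])
  then show ?thesis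
    using sub fin
    by (simp add: extremal_graph_def card_Diff_subset finite_subset card_removed_edges)
qed

section \<open>The Turan number from the two bounds\<close>

theorem theorem1:
  fixes r k :: nat and n :: "nat \<Rightarrow> nat"
  assumes "3 \<le> r"
    and "1 \<le> k" and "k \<le> n 1"
    and "mono_on {1..r} n"
  shows "int (turan_number (complete_multipartite r n) (disjoint_copies k (complete_graph r)))
       = (\<Sum>(i, j) \<in> {(i, j). 1 \<le> i \<and> i < j \<and> j \<le> r}. int (n i) * int (n j))
         - int (n 1) * int (n 2) + int (n 2) * (int k - 1)"
proof -
  let ?K = "complete_multipartite r n" and ?H = "disjoint_copies k (complete_graph r)"
  let ?E = "extremal_graph r k n"
  have r: "2 \<le> r" and pos: "0 < n 1" using assms by auto
  have fin: "finite (edges ?K)"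
    by (intro finite_edges simple_graph_complete_multipartite)
  have "turan_number ?K ?H = card (edges ?E)"
    unfolding turan_number_def
  proof (rule Max_eqI)
    show "finite {card (edges G') | G'. subgraph G' ?K \<and> \<not> contains_copy G' ?H}"
      by (intro finite_turan_candidates simple_graph_complete_multipartite)
    show "card (edges ?E) \<in> {card (edges G') | G'. subgraph G' ?K \<and> \<not> contains_copy G' ?H}"
      using subgraph_extremal_graph extremal_graph_no_copy[OF r assms(2)] by blast
  next
    fix y assume "y \<in> {card (edges G') | G'. subgraph G' ?K \<and> \<not> contains_copy G' ?H}"
    then obtain G where G: "subgraph G ?K" "\<not> contains_copy G ?H" and y: "y = card (edges G)"
      by blast
    have "edges G \<subseteq> edges ?K" using G(1) by (simp add: subgraph_def)
    then have "card (edges ?K - edges G) + card (edges G) = card (edges ?K)"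
      using fin by (metis add.commute card_Diff_subset card_mono finite_subset le_add_diff_inverse)
    moreover have "n 2 * (n 1 - k + 1) \<le> card (edges ?K - edges G)"
      by (rule missing_edges_lower_bound[OF G(1) r pos assms(3,4) G(2) refl])
    \<comment> \<open>The two counts of missing edges are written differently and agree because
      \<open>k \<le> n 1\<close>.\<close>
    moreover have "Suc (n 1) - k = n 1 - k + 1" using assms(3) by simp
    ultimately show "y \<le> card (edges ?E)"
      using card_edges_extremal_graph[OF r assms(2), of n] y by simp
  qed
  \<comment> \<open>In the integers the removed amount \<open>n 2 * (n 1 - k + 1)\<close> expands to
    \<open>n 1 * n 2 - n 2 * (k - 1)\<close>, the form of the claim.\<close>
  moreover have "int (card (edges ?E)) + int (n 2) * (1 + int (n 1) - int k) = int (card (edges ?K))"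
    using arg_cong[OF card_edges_extremal_graph[OF r assms(2), of n], of int] assms(3)
    by (simp add: of_nat_diff)
  moreover have "int (card (edges ?K))
      = (\<Sum>(i, j) \<in> {(i, j). 1 \<le> i \<and> i < j \<and> j \<le> r}. int (n i) * int (n j))"
    by (simp add: card_edges_complete_multipartite case_prod_beta)
  ultimately show ?thesis
    by (simp add: algebra_simps)
qed

end
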